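(* Let $M,N,\chi,L_x,L_y>0$ be real and $m,n$ positive integers, with the associated grid, operators, functions $S,H,\kappa$ and discrete energy $F$ described in the context. Then the following scheme is unconditionally energy stable: for every time step $s>0$, if $\phi^k,\phi^{k+1}\in\mathcal{C}_{\overline m\times\overline n}$ are periodic with values in $(0,1/\rho)$ and satisfy, on $C_m\times C_n$, $$\phi^{k+1}-\phi^k=s\,\Delta_h\mu^{k+1},$$ where $$\mu^{k+1}=S'(\phi^{k+1})+\kappa'(\phi^{k+1})\big(a_x((D_x\phi^{k+1})^2)+a_y((D_y\phi^{k+1})^2)\big)-2d_x\big(A_x\kappa(\phi^{k+1})\,D_x\phi^{k+1}\big)-2d_y\big(A_y\kappa(\phi^{k+1})\,D_y\phi^{k+1}\big)+H'(\phi^k)$$ on $C_m\times C_n$ and $\mu^{k+1}$ is extended periodically to $C_{\overline m}\times C_{\overline n}$, then $$F(\phi^{k+1})\le F(\phi^k).$$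
   Context: Parameters: $\alpha=\pi\big(\sqrt{M/\pi}+N/2\big)^2$, $\beta=\alpha/\sqrt{\pi M}$, $\tau=\sqrt{\pi M}\,N$, $\rho=1+M/\tau$. For $\phi\in(0,1/\rho)\subset(0,1)$: $S(\phi)=\frac{\phi}{\tau}\ln\frac{\alpha\phi}{\tau}+\frac{\phi}{N}\ln\frac{\beta\phi}{\tau}+(1-\rho\phi)\ln(1-\rho\phi)$, $H(\phi)=\chi\phi(1-\rho\phi)$, $\kappa(\phi)=\frac{1}{36\phi(1-\phi)}$. Additive constants in $S'$ and $H'$ are dropped in the scheme (they are annihilated by $\Delta_h$), so in the scheme $S'(\phi)=\big(\frac1\tau+\frac1N\big)\ln\phi-\rho\ln(1-\rho\phi)$, $H'(\phi)=-2\chi\rho\phi$, $\kappa'(\phi)=\frac{2\phi-1}{36\phi^2(1-\phi)^2}$. Grid: $h_x=L_x/m$, $h_y=L_y/n$; $x_i=(i-\frac12)h_x$, $y_j=(j-\frac12)h_y$ (for integer or half-integer indices). $C_m=\{x_i: 1\le i\le m\}$, $C_{\overline m}=\{x_i: 0\le i\le m+1\}$, $E_m=\{x_{i+1/2}:0\le i\le m\}$; similarly $C_n,C_{\overline n},E_n$ in $y$. $\mathcal{C}_{\overline m\times\overline n}$ is the space of functions $\phi:C_{\overline m}\times C_{\overline n}\to\mathbb{R}$, $\phi_{i,j}=\phi(x_i,y_j)$. Such $\phi$ is periodic if $\phi_{m+1,j}=\phi_{1,j}$, $\phi_{0,j}=\phi_{m,j}$ for $1\le j\le n$ and $\phi_{i,n+1}=\phi_{i,1}$,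 $\phi_{i,0}=\phi_{i,n}$ for $0\le i\le m+1$. Operators. For $f$ defined on $E_m\times C_n$: $a_xf_{i,j}=\frac12(f_{i+\frac12,j}+f_{i-\frac12,j})$, $d_xf_{i,j}=\frac1{h_x}(f_{i+\frac12,j}-f_{i-\frac12,j})$, $1\le i\le m$, $1\le j\le n$. For $g$ defined on $C_m\times E_n$: $a_yg_{i,j}=\frac12(g_{i,j+\frac12}+g_{i,j-\frac12})$, $d_yg_{i,j}=\frac1{h_y}(g_{i,j+\frac12}-g_{i,j-\frac12})$. For $\phi\in\mathcal{C}_{\overline m\times\overline n}$: $A_x\phi_{i+\frac12,j}=\frac12(\phi_{i+1,j}+\phi_{i,j})$, $D_x\phi_{i+\frac12,j}=\frac1{h_x}(\phi_{i+1,j}-\phi_{i,j})$ for $0\le i\le m$, $1\le j\le n$; $A_y\phi_{i,j+\frac12}=\frac12(\phi_{i,j+1}+\phi_{i,j})$, $D_y\phi_{i,j+\frac12}=\frac1{h_y}(\phi_{i,j+1}-\phi_{i,j})$ for $1\le i\le m$, $0\le j\le n$; and $\Delta_h\phi_{i,j}=d_x(D_x\phi)_{i,j}+d_y(D_y\phi)_{i,j}$ for $1\le i\le m$, $1\le j\le n$. Products, squares and compositions with scalar functions are taken pointwise. Discrete energy: $$F(\phi)=h_xh_y\sum_{i=1}^m\sum_{j=1}^n\Big(S(\phi_{i,j})+H(\phi_{i,j})+\kappa(\phi_{i,j})\big(a_x((D_x\phi)^2)_{i,j}+a_y((D_y\phi)^2)_{i,j}\big)\Big).$$ *)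

theory Defs
  imports "HOL-Analysis.Analysis"
begin

definition alpha :: "real \<Rightarrow> real \<Rightarrow> real" where
  "alpha M N = pi * (sqrt (M / pi) + N / 2)^2"

definition beta :: "real \<Rightarrow> real \<Rightarrow> real" where
  "beta M N = alpha M N / sqrt (pi * M)"

definition tau :: "real \<Rightarrow> real \<Rightarrow> real" where
  "tau M N = sqrt (pi * M) * N"

definition rho :: "real \<Rightarrow> real \<Rightarrow> real" where
  "rho M N = 1 + M / tau M N"

definition S_fun :: "real \<Rightarrow> real \<Rightarrow> real \<Rightarrow> real" where
  "S_fun M N v =
     v / tau M N * ln (alpha M N * v / tau M N)
     + v / N * ln (beta M N * v / tau M N)
     + (1 - rho M N * v) * ln (1 - rho M N * v)"

definition H_fun :: "real \<Rightarrow> real \<Rightarrow> real \<Rightarrow> real \<Rightarrow> real" where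
  "H_fun M N chi v = chi * v * (1 - rho M N * v)"

definition kappa :: "real \<Rightarrow> real" where
  "kappa v = 1 / (36 * v * (1 - v))"

text \<open>
  The scheme drops the additive constants in the derivatives of \<open>S_fun\<close> and \<open>H_fun\<close>;
  see \<open>S_fun_deriv\<close> and \<open>H_fun_deriv\<close> below for the exact relation.
\<close>

definition S_der :: "real \<Rightarrow> real \<Rightarrow> real \<Rightarrow> real" where
  "S_der M N v = (1 / tau M N + 1 / N) * ln v - rho M N * ln (1 - rho M N * v)"

definition H_der :: "real \<Rightarrow> real \<Rightarrow> real \<Rightarrow> real \<Rightarrow> real" where
  "H_der M N chi v = - 2 * chi * rho M N * v"

definition kappa_der :: "real \<Rightarrow> real" where
  "kappa_der v = (2 * v - 1) / (36 * v^2 * (1 - v)^2)"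

text \<open>
  A grid function is represented by its array of values. A function \<open>\<phi>\<close> on the cell centres
  (with ghost cells) has \<open>\<phi> i j\<close> as its value at the point \<open>(x\<^sub>i, y\<^sub>j)\<close>. For a function \<open>f\<close> on
  the vertical edges, \<open>f i j\<close> is the value at the point with half-integer index \<open>(i + 1/2, j)\<close>, and
  for a function \<open>g\<close> on the horizontal edges, \<open>g i j\<close> is the value at index \<open>(i, j + 1/2)\<close>.
  Values outside the index range of the grid are junk and are never used: all hypotheses and
  sums range over the grid only.
\<close>

type_synonym grid_fun = "int \<Rightarrow> int \<Rightarrow> real"

definition grid_periodic :: "nat \<Rightarrow> nat \<Rightarrow> grid_fun \<Rightarrow> bool" where
  "grid_periodic m n \<phi> \<longleftrightarrow>
     (\<forall>j\<in>{1..int n}. \<phi> (int m + 1) j = \<phi> 1 j \<and> \<phi> 0 j = \<phi> (int m) j) \<and>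
     (\<forall>i\<in>{0..int m + 1}. \<phi> i (int n + 1) = \<phi> i 1 \<and> \<phi> i 0 = \<phi> i (int n))"

text \<open>From edges to cell centres.\<close>

definition a_x :: "grid_fun \<Rightarrow> grid_fun" where
  "a_x f i j = (f i j + f (i - 1) j) / 2"

definition d_x :: "real \<Rightarrow> grid_fun \<Rightarrow> grid_fun" where
  "d_x hx f i j = (f i j - f (i - 1) j) / hx"

definition a_y :: "grid_fun \<Rightarrow> grid_fun" where
  "a_y g i j = (g i j + g i (j - 1)) / 2"

definition d_y :: "real \<Rightarrow> grid_fun \<Rightarrow> grid_fun" where
  "d_y hy g i j = (g i j - g i (j - 1)) / hy"

text \<open>From cell centres to edges.\<close>

definition A_x :: "grid_fun \<Rightarrow> grid_fun" where
  "A_x \<phi> i j = (\<phi> (i + 1) j + \<phi> i j) / 2"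

definition D_x :: "real \<Rightarrow> grid_fun \<Rightarrow> grid_fun" where
  "D_x hx \<phi> i j = (\<phi> (i + 1) j - \<phi> i j) / hx"

definition A_y :: "grid_fun \<Rightarrow> grid_fun" where
  "A_y \<phi> i j = (\<phi> i (j + 1) + \<phi> i j) / 2"

definition D_y :: "real \<Rightarrow> grid_fun \<Rightarrow> grid_fun" where
  "D_y hy \<phi> i j = (\<phi> i (j + 1) - \<phi> i j) / hy"

definition laplace_h :: "real \<Rightarrow> real \<Rightarrow> grid_fun \<Rightarrow> grid_fun" where
  "laplace_h hx hy \<phi> i j = d_x hx (D_x hx \<phi>) i j + d_y hy (D_y hy \<phi>) i j"

definition grad_sq :: "real \<Rightarrow> real \<Rightarrow> grid_fun \<Rightarrow> grid_fun" where
  "grad_sq hx hy \<phi> i j =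
     a_x (\<lambda>i j. (D_x hx \<phi> i j)^2) i j + a_y (\<lambda>i j. (D_y hy \<phi> i j)^2) i j"

definition discrete_energy ::
  "real \<Rightarrow> real \<Rightarrow> real \<Rightarrow> real \<Rightarrow> real \<Rightarrow> nat \<Rightarrow> nat \<Rightarrow> grid_fun \<Rightarrow> real" where
  "discrete_energy M N chi hx hy m n \<phi> =
     hx * hy * (\<Sum>i = 1..int m. \<Sum>j = 1..int n.
       S_fun M N (\<phi> i j) + H_fun M N chi (\<phi> i j) + kappa (\<phi> i j) * grad_sq hx hy \<phi> i j)"

definition scheme_potential ::
  "real \<Rightarrow> real \<Rightarrow> real \<Rightarrow> real \<Rightarrow> real \<Rightarrow> grid_fun \<Rightarrow> grid_fun \<Rightarrow> grid_fun" where
  "scheme_potential M N chi hx hy \<phi>old \<phi>new i j =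
     S_der M N (\<phi>new i j)
     + kappa_der (\<phi>new i j) * grad_sq hx hy \<phi>new i j
     - 2 * d_x hx (\<lambda>i j. A_x (\<lambda>i j. kappa (\<phi>new i j)) i j * D_x hx \<phi>new i j) i j
     - 2 * d_y hy (\<lambda>i j. A_y (\<lambda>i j. kappa (\<phi>new i j)) i j * D_y hy \<phi>new i j) i j
     + H_der M N chi (\<phi>old i j)"

lemma tau_pos: "M > 0 \<Longrightarrow> N > 0 \<Longrightarrow> tau M N > 0"
  by (simp add: tau_def)

lemma rho_gt_1: "M > 0 \<Longrightarrow> N > 0 \<Longrightarrow> rho M N > 1"
  by (simp add: rho_def tau_pos)

lemma alpha_pos: "M > 0 \<Longrightarrow> N > 0 \<Longrightarrow> alpha M N > 0"
  unfolding alpha_def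
  by (intro mult_pos_pos pi_gt_zero zero_less_power add_pos_pos real_sqrt_gt_zero) auto

lemma beta_pos: "M > 0 \<Longrightarrow> N > 0 \<Longrightarrow> beta M N > 0"
  by (simp add: beta_def alpha_pos)

lemma S_fun_deriv:
  assumes "M > 0" "N > 0" "0 < v" "v < 1 / rho M N"
  shows "(S_fun M N has_real_derivative
     S_der M N v + ((ln (alpha M N / tau M N) + 1) / tau M N
       + (ln (beta M N / tau M N) + 1) / N - rho M N)) (at v)"
proof -
  define a b t r where "a = alpha M N" and "b = beta M N" and "t = tau M N" and "r = rho M N"
  have pos: "a > 0" "b > 0" "t > 0" "r > 1"
    using assms alpha_pos beta_pos tau_pos rho_gt_1 by (auto simp: a_def b_def t_def r_def)
  have rv: "1 - r * v > 0"
    using assms(4) pos by (simp add: r_def[symmetric] field_simps)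
  have ln_a: "ln (a * v / t) = ln (a / t) + ln v"
    using pos assms(3) by (simp add: ln_mult ln_div)
  have ln_b: "ln (b * v / t) = ln (b / t) + ln v"
    using pos assms(3) by (simp add: ln_mult ln_div)
  have A: "((\<lambda>v. v / t * ln (a * v / t)) has_real_derivative (ln (a * v / t) + 1) / t) (at v)"
    using pos assms(3) by (auto intro!: derivative_eq_intros simp: divide_simps)
  have B: "((\<lambda>v. v / N * ln (b * v / t)) has_real_derivative (ln (b * v / t) + 1) / N) (at v)"
    using pos assms(2,3) by (auto intro!: derivative_eq_intros simp: divide_simps)
  have C: "((\<lambda>v. (1 - r * v) * ln (1 - r * v)) has_real_derivative - r * ln (1 - r * v) - r) (at v)"
    using rv by (auto intro!: derivative_eq_intros)
  from DERIV_add[OF DERIV_add[OF A B] C]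
  show ?thesis
    unfolding S_fun_def[abs_def] S_der_def a_def[symmetric] b_def[symmetric] t_def[symmetric]
      r_def[symmetric] ln_a ln_b
    by (rule back_subst[where P = "\<lambda>d. (_ has_real_derivative d) _"])
       (use pos assms(2) in \<open>simp add: field_simps\<close>)
qed

lemma H_fun_deriv: "(H_fun M N chi has_real_derivative H_der M N chi v + chi) (at v)"
  unfolding H_fun_def[abs_def] H_der_def
  by (auto intro!: derivative_eq_intros simp: algebra_simps)

lemma kappa_deriv:
  assumes "0 < v" "v < 1"
  shows "(kappa has_real_derivative kappa_der v) (at v)"
  unfolding kappa_def[abs_def] kappa_der_def
  using assms by (auto intro!: derivative_eq_intros simp: divide_simps power2_eq_square)
     (simp add: algebra_simps)

end

theory Submission
  imports Defs
begin

text \<open>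
  Testing the scheme with \<open>\<mu>\<close> and summing by parts shows that \<open>\<phi>new - \<phi>old\<close> has zero mean and
  that its pairing with \<open>\<mu>\<close> is \<open>- s\<close> times the squared norm of the discrete gradient of \<open>\<mu>\<close>. The
  pairing in turn dominates the energy increment: \<open>S\<close> and \<open>(v, q) \<mapsto> kappa v * q^2\<close> are convex and
  taken implicitly, \<open>H\<close> is concave and taken explicitly, so each contribution follows from a tangent
  inequality at one grid point. The dropped additive constants pair to zero by the zero mean.
\<close>

section \<open>Tangent inequalities\<close>

text \<open>The tangent defect is \<open>v - u - u * ln (v / u)\<close>: \<open>ln c\<close>
  cancels, and the bound \<open>ln y \<le> y - 1\<close> at \<open>y = v / u\<close>
  suffices.\<close>

lemma mult_ln_above_tangent:
  fixes c u v :: real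
  assumes "c > 0" "u > 0" "v > 0"
  shows "v * ln (c * v) + (ln (c * v) + 1) * (u - v) \<le> u * ln (c * u)"
proof -
  have "ln (v / u) \<le> v / u - 1"
    using assms by (intro ln_le_minus_one) simp
  then have "u * ln (v / u) \<le> v - u"
    using assms by (simp add: field_simps)
  moreover have "ln (v / u) = ln (c * v) - ln (c * u)"
    using assms by (simp add: ln_mult ln_div)
  ultimately show ?thesis
    by (simp add: algebra_simps)
qed

text \<open>A positively weighted sum of terms \<open>x * ln (c * x)\<close> in positive affine
  functions of the argument is convex. \<open>C\<close> restores the additive constants omitted from
  \<open>S_der\<close>; only its independence of \<open>u\<close> and \<open>v\<close> matters,
  since it is later paired with a function of zero mean.\<close>

lemma S_fun_above_tangent:
  assumes "M > 0" "N > 0"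
  obtains C where "\<And>u v. u \<in> {0<..<1 / rho M N} \<Longrightarrow> v \<in> {0<..<1 / rho M N} \<Longrightarrow>
    S_fun M N v + (S_der M N v + C) * (u - v) \<le> S_fun M N u"
proof -
  define a b t r where "a = alpha M N / tau M N" and "b = beta M N / tau M N"
    and "t = tau M N" and "r = rho M N"
  have pos: "a > 0" "b > 0" "t > 0" "r > 1"
    using assms alpha_pos beta_pos tau_pos rho_gt_1 by (auto simp: a_def b_def t_def r_def)
  have "S_fun M N v + (S_der M N v + ((ln a + 1) / t + (ln b + 1) / N - r)) * (u - v)
      \<le> S_fun M N u" if u: "u \<in> {0<..<1 / rho M N}" and v: "v \<in> {0<..<1 / rho M N}" for u v
  proof -
    have uv: "u > 0" "v > 0" "1 - r * u > 0" "1 - r * v > 0"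
      using u v pos by (auto simp: r_def[symmetric] field_simps)
    define T where "T c u v = u * ln (c * u) - v * ln (c * v) - (ln (c * v) + 1) * (u - v)"
      for c u v :: real
    have T: "T c u v \<ge> 0" if "c > 0" "u > 0" "v > 0" for c u v
      using mult_ln_above_tangent[OF that] by (simp add: T_def)
    have S: "S_fun M N w = w * ln (a * w) / t + w * ln (b * w) / N + (1 - r * w) * ln (1 - r * w)"
      for w by (simp add: S_fun_def a_def b_def t_def r_def)
    \<comment> \<open>In the third defect the inner derivative \<open>- r\<close> produces both
      \<open>- r * ln (1 - r * v)\<close> in \<open>S_der\<close> and the constant
      \<open>- r\<close>.\<close>
    have "S_fun M N u - S_fun M N v
        - (S_der M N v + ((ln a + 1) / t + (ln b + 1) / N - r)) * (u - v)
        = T a u v / t + T b u v / N + T 1 (1 - r * u) (1 - r * v)"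
      unfolding S S_der_def t_def[symmetric] r_def[symmetric] T_def
      using pos assms uv by (simp add: ln_mult field_simps)
    moreover have "T a u v / t \<ge> 0" "T b u v / N \<ge> 0" "T 1 (1 - r * u) (1 - r * v) \<ge> 0"
      using T pos uv assms by (simp_all add: less_imp_le)
    ultimately show ?thesis
      by linarith
  qed
  then show thesis
    using that by blast
qed

text \<open>The gap of a quadratic to its tangent is exact, here
  \<open>chi * rho M N * (v - u)^2\<close>. The tangent point \<open>u\<close> will be the old
  value, matching the explicit treatment of \<open>H\<close>; the summand \<open>chi\<close> is the
  constant dropped from \<open>H_der\<close>.\<close>

lemma H_fun_below_tangent:
  assumes "M > 0" "N > 0" "chi > 0"
  shows "H_fun M N chi v \<le> H_fun M N chi u + (H_der M N chi u + chi) * (v - u)"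
proof -
  have "H_fun M N chi u + (H_der M N chi u + chi) * (v - u) - H_fun M N chi v
      = chi * rho M N * (v - u)^2"
    by (simp add: H_fun_def H_der_def power2_eq_square algebra_simps)
  also have "\<dots> \<ge> 0"
    using assms rho_gt_1[OF assms(1,2)] by simp
  finally show ?thesis
    by simp
qed

text \<open>
  The map \<open>(w, p) \<mapsto> p^2 / w\<close> is jointly convex and decreasing in \<open>w > 0\<close>, and \<open>v * (1 - v)\<close> is
  concave; the defect is a sum of two squares.
\<close>

lemma kappa_mult_square_above_tangent:
  assumes "0 < u" "u < 1" "0 < v" "v < 1"
  shows "kappa v * q^2 + kappa_der v * q^2 * (u - v) + 2 * kappa v * (q * (p - q)) \<le> kappa u * p^2"
proof -
  define w z where "w = u * (1 - u)" and "z = v * (1 - v)"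
  have pos: "w > 0" "z > 0"
    using assms by (simp_all add: w_def z_def)
  \<comment> \<open>Exact Taylor expansion of the concave quadratic at \<open>v\<close>; its last
    term becomes the second square of the defect.\<close>
  have w: "w = z + (1 - 2 * v) * (u - v) - (u - v)^2"
    by (simp add: w_def z_def power2_eq_square algebra_simps)
  have k: "kappa u = 1 / (36 * w)" "kappa v = 1 / (36 * z)"
    "kappa_der v = (2 * v - 1) / (36 * z^2)"
    by (simp_all add: kappa_def kappa_der_def w_def z_def power_mult_distrib mult.assoc)
  have "36 * (kappa u * p^2
      - (kappa v * q^2 + kappa_der v * q^2 * (u - v) + 2 * kappa v * (q * (p - q))))
      = p^2 / w - 2 * p * q / z + q^2 / z + q^2 * ((1 - 2 * v) * (u - v)) / z^2"
    unfolding k using pos by (simp add: field_simps power2_eq_square)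
  also have "\<dots> = p^2 / w - 2 * p * q / z + q^2 * (z + (1 - 2 * v) * (u - v)) / z^2"
    using pos by (simp add: field_simps power2_eq_square)
  also have "\<dots> = p^2 / w - 2 * p * q / z + q^2 * (w + (u - v)^2) / z^2"
    unfolding w by simp
  \<comment> \<open>Completing the square in \<open>p\<close>.\<close>
  also have "\<dots> = (p - q * w / z)^2 / w + q^2 * (u - v)^2 / z^2"
    using pos by (simp add: field_simps power2_eq_square)
  also have "\<dots> \<ge> 0"
    using pos by simp
  finally show ?thesis
    by simp
qed

text \<open>The scalar inequality is applied on each of the four edges of a cell, with the same two
  centre values and the edge differences as \<open>p\<close> and \<open>q\<close>, and then averaged
  in each direction.\<close>

lemma kappa_mult_grad_sq_above_tangent:
  assumes "0 < \<phi> i j" "\<phi> i j < 1" "0 < \<psi> i j" "\<psi> i j < 1"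
  shows "kappa (\<psi> i j) * grad_sq hx hy \<psi> i j
      + kappa_der (\<psi> i j) * grad_sq hx hy \<psi> i j * (\<phi> i j - \<psi> i j)
      + 2 * (kappa (\<psi> i j) * a_x (\<lambda>i j. D_x hx \<psi> i j * D_x hx (\<lambda>i j. \<phi> i j - \<psi> i j) i j) i j
        + kappa (\<psi> i j) * a_y (\<lambda>i j. D_y hy \<psi> i j * D_y hy (\<lambda>i j. \<phi> i j - \<psi> i j) i j) i j)
      \<le> kappa (\<phi> i j) * grad_sq hx hy \<phi> i j"
proof -
  have D: "D_x hx (\<lambda>i j. \<phi> i j - \<psi> i j) i j = D_x hx \<phi> i j - D_x hx \<psi> i j"
    "D_y hy (\<lambda>i j. \<phi> i j - \<psi> i j) i j = D_y hy \<phi> i j - D_y hy \<psi> i j" for i j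
    by (simp_all add: D_x_def D_y_def diff_divide_distrib)
  note T = kappa_mult_square_above_tangent[OF assms]
  show ?thesis
    unfolding grad_sq_def a_x_def a_y_def D
    using T[of "D_x hx \<psi> i j" "D_x hx \<phi> i j"] T[of "D_x hx \<psi> (i - 1) j" "D_x hx \<phi> (i - 1) j"]
      T[of "D_y hy \<psi> i j" "D_y hy \<phi> i j"] T[of "D_y hy \<psi> i (j - 1)" "D_y hy \<phi> i (j - 1)"]
    by (simp add: field_simps)
qed

section \<open>Summation by parts\<close>

lemma sum_periodic_shift:
  fixes f :: "int \<Rightarrow> 'a :: ab_group_add"
  assumes "f (int m + 1) = f 1"
  shows "(\<Sum>i = 1..int m. f (i + 1)) = (\<Sum>i = 1..int m. f i)"
proof -
  \<comment> \<open>The bound \<open>m\<close> is fresh, so the induction for the telescoping sum is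
    free of the periodicity hypothesis.\<close>
  have "(\<Sum>i = 1..int m. f (i + 1) - f i) = f (int m + 1) - f 1" for m
  proof (induction m)
    case (Suc m)
    have "{1..int (Suc m)} = insert (int m + 1) {1..int m}"
      by auto
    with Suc show ?case
      by (simp add: add.commute)
  qed simp
  from this[of m] assms show ?thesis
    by (simp add: sum_subtractf)
qed

lemma sum_diff_by_parts:
  fixes c e :: "int \<Rightarrow> real"
  assumes "c 0 = c (int m)" "e (int m + 1) = e 1"
  shows "(\<Sum>i = 1..int m. (c i - c (i - 1)) / h * e i)
    = - (\<Sum>i = 1..int m. c i * ((e (i + 1) - e i) / h))"
proof -
  \<comment> \<open>The end values \<open>c (int m) * e (int m + 1)\<close> and
    \<open>c 0 * e 1\<close> agree by periodicity, so no boundary term arises.\<close>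
  have "(\<Sum>i = 1..int m. c i * e (i + 1) / h) = (\<Sum>i = 1..int m. c (i - 1) * e i / h)"
    using sum_periodic_shift[of "\<lambda>i. c (i - 1) * e i / h" m] assms by simp
  then show ?thesis
    by (simp add: algebra_simps diff_divide_distrib sum_subtractf)
qed

text \<open>The two averages are adjoint under periodicity. This turns a weight at cell centres into
  its edge average, the form in which \<open>kappa\<close> enters the flux of the scheme.\<close>

lemma sum_mult_edge_average:
  fixes k b :: "int \<Rightarrow> real"
  assumes "b 0 = b (int m)" "k (int m + 1) = k 1"
  shows "(\<Sum>i = 1..int m. k i * ((b i + b (i - 1)) / 2))
    = (\<Sum>i = 1..int m. (k (i + 1) + k i) / 2 * b i)"
proof -
  have "(\<Sum>i = 1..int m. k (i + 1) * b i / 2) = (\<Sum>i = 1..int m. k i * b (i - 1) / 2)"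
    using sum_periodic_shift[of "\<lambda>i. k i * b (i - 1) / 2" m] assms by simp
  then show ?thesis
    by (simp add: algebra_simps add_divide_distrib sum.distrib)
qed

text \<open>
  The index \<open>i - 1 + 1\<close> is left as it arises from unfolding \<open>d_x\<close> and \<open>A_x\<close>, so that the right-hand
  side unifies with the unfolded operators.
\<close>

lemma sum_mult_edge_average_by_parts:
  fixes k u e :: "int \<Rightarrow> real" and h :: real
  assumes "k 0 = k (int m)" "k (int m + 1) = k 1" "u 0 = u (int m)" "u (int m + 1) = u 1"
    "e 0 = e (int m)" "e (int m + 1) = e 1"
  defines "D \<equiv> \<lambda>f i. (f (i + 1) - f i) / h"
  shows "(\<Sum>i = 1..int m. k i * ((D u i * D e i + D u (i - 1) * D e (i - 1)) / 2))
    = - (\<Sum>i = 1..int m. ((k (i + 1) + k i) / 2 * D u i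
          - (k (i - 1 + 1) + k (i - 1)) / 2 * D u (i - 1)) / h * e i)"
proof -
  \<comment> \<open>Index 0 denotes the edge at 1/2, which periodicity identifies with the edge at
    \<open>m + 1/2\<close>.\<close>
  have D: "D u 0 = D u (int m)" "D e 0 = D e (int m)"
    using assms by (simp_all add: D_def)
  have "(\<Sum>i = 1..int m. k i * ((D u i * D e i + D u (i - 1) * D e (i - 1)) / 2))
      = (\<Sum>i = 1..int m. (k (i + 1) + k i) / 2 * (D u i * D e i))"
    using sum_mult_edge_average[of "\<lambda>i. D u i * D e i" m k] assms(1,2) D by simp
  also have "\<dots> = (\<Sum>i = 1..int m. (k (i + 1) + k i) / 2 * D u i * ((e (i + 1) - e i) / h))"
    by (simp add: D_def mult.assoc)
  also have "\<dots> = - (\<Sum>i = 1..int m. ((k (i + 1) + k i) / 2 * D u i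
          - (k (i - 1 + 1) + k (i - 1)) / 2 * D u (i - 1)) / h * e i)"
    using sum_diff_by_parts[of "\<lambda>i. (k (i + 1) + k i) / 2 * D u i" m e h] assms(1,2,6) D by simp
  finally show ?thesis .
qed

lemma grid_periodicD:
  assumes "grid_periodic m n \<phi>"
  shows "j \<in> {1..int n} \<Longrightarrow> \<phi> (int m + 1) j = \<phi> 1 j"
    and "j \<in> {1..int n} \<Longrightarrow> \<phi> 0 j = \<phi> (int m) j"
    and "i \<in> {1..int m} \<Longrightarrow> \<phi> i (int n + 1) = \<phi> i 1"
    and "i \<in> {1..int m} \<Longrightarrow> \<phi> i 0 = \<phi> i (int n)"
  using assms by (auto simp: grid_periodic_def)

lemma grid_periodic_compose: "grid_periodic m n \<phi> \<Longrightarrow> grid_periodic m n (\<lambda>i j. f (\<phi> i j))"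
  by (simp add: grid_periodic_def)

lemma grid_periodic_diff:
  "grid_periodic m n \<phi> \<Longrightarrow> grid_periodic m n \<psi> \<Longrightarrow> grid_periodic m n (\<lambda>i j. \<phi> i j - \<psi> i j)"
  by (simp add: grid_periodic_def)

text \<open>With \<open>kappa\<close> of the new values as \<open>k\<close>, this links the first
  variation of the gradient energy to the flux term of the scheme. The one-dimensional identity
  applies for each fixed \<open>j\<close>, hence the exchange of sums.\<close>

lemma sum_mult_a_x_by_parts:
  assumes "grid_periodic m n k" "grid_periodic m n u" "grid_periodic m n e"
  shows "(\<Sum>i = 1..int m. \<Sum>j = 1..int n. k i j * a_x (\<lambda>i j. D_x h u i j * D_x h e i j) i j)
    = - (\<Sum>i = 1..int m. \<Sum>j = 1..int n. d_x h (\<lambda>i j. A_x k i j * D_x h u i j) i j * e i j)"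
proof -
  have "(\<Sum>i = 1..int m. k i j * a_x (\<lambda>i j. D_x h u i j * D_x h e i j) i j)
      = - (\<Sum>i = 1..int m. d_x h (\<lambda>i j. A_x k i j * D_x h u i j) i j * e i j)"
    if j: "j \<in> {1..int n}" for j
    unfolding a_x_def D_x_def d_x_def A_x_def
    using assms[THEN grid_periodicD(1), OF j] assms[THEN grid_periodicD(2), OF j]
    by (intro sum_mult_edge_average_by_parts) simp_all
  then show ?thesis
    by (subst (1 2) sum.swap) (simp add: sum_negf)
qed

lemma sum_mult_a_y_by_parts:
  assumes "grid_periodic m n k" "grid_periodic m n u" "grid_periodic m n e"
  shows "(\<Sum>i = 1..int m. \<Sum>j = 1..int n. k i j * a_y (\<lambda>i j. D_y h u i j * D_y h e i j) i j)
    = - (\<Sum>i = 1..int m. \<Sum>j = 1..int n. d_y h (\<lambda>i j. A_y k i j * D_y h u i j) i j * e i j)"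
proof -
  have "(\<Sum>j = 1..int n. k i j * a_y (\<lambda>i j. D_y h u i j * D_y h e i j) i j)
      = - (\<Sum>j = 1..int n. d_y h (\<lambda>i j. A_y k i j * D_y h u i j) i j * e i j)"
    if i: "i \<in> {1..int m}" for i
    unfolding a_y_def D_y_def d_y_def A_y_def
    using assms[THEN grid_periodicD(3), OF i] assms[THEN grid_periodicD(4), OF i]
    by (intro sum_mult_edge_average_by_parts) simp_all
  then show ?thesis
    by (simp add: sum_negf)
qed

text \<open>This is the case of weight 1, whose edge averages are 1 as well, added over both
  directions.\<close>

lemma sum_laplace_h_mult:
  assumes "grid_periodic m n u" "grid_periodic m n e"
  shows "(\<Sum>i = 1..int m. \<Sum>j = 1..int n. laplace_h hx hy u i j * e i j)
    = - (\<Sum>i = 1..int m. \<Sum>j = 1..int n.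
          a_x (\<lambda>i j. D_x hx u i j * D_x hx e i j) i j + a_y (\<lambda>i j. D_y hy u i j * D_y hy e i j) i j)"
proof -
  have 1: "grid_periodic m n (\<lambda>i j. 1)"
    by (simp add: grid_periodic_def)
  show ?thesis
    using sum_mult_a_x_by_parts[OF 1 assms, of hx] sum_mult_a_y_by_parts[OF 1 assms, of hy]
    by (simp add: laplace_h_def A_x_def A_y_def distrib_right sum.distrib)
qed

section \<open>Energy stability\<close>

theorem theorem3p10:
  fixes M N chi Lx Ly hx hy s :: real
    and m n :: nat
    and \<phi>old \<phi>new \<mu> :: grid_fun
  assumes "M > 0" and "N > 0" and "chi > 0" and "Lx > 0" and "Ly > 0"
    and "m > 0" and "n > 0"
    and "hx = Lx / real m" and "hy = Ly / real n"
    and "s > 0"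
    and "grid_periodic m n \<phi>old"
    and "grid_periodic m n \<phi>new"
    and "\<forall>i\<in>{0..int m + 1}. \<forall>j\<in>{0..int n + 1}. \<phi>old i j \<in> {0<..<1 / rho M N}"
    and "\<forall>i\<in>{0..int m + 1}. \<forall>j\<in>{0..int n + 1}. \<phi>new i j \<in> {0<..<1 / rho M N}"
    and "grid_periodic m n \<mu>"
    and "\<forall>i\<in>{1..int m}. \<forall>j\<in>{1..int n}.
           \<mu> i j = scheme_potential M N chi hx hy \<phi>old \<phi>new i j"
    and "\<forall>i\<in>{1..int m}. \<forall>j\<in>{1..int n}.
           \<phi>new i j - \<phi>old i j = s * laplace_h hx hy \<mu> i j"
  shows "discrete_energy M N chi hx hy m n \<phi>new \<le> discrete_energy M N chi hx hy m n \<phi>old"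
proof -
  \<comment> \<open>Old minus new, the direction in which tangents at the new values are
    evaluated.\<close>
  define e :: grid_fun where "e = (\<lambda>i j. \<phi>old i j - \<phi>new i j)"
  have \<phi>old: "\<phi>old i j \<in> {0<..<1 / rho M N}" and \<phi>new: "\<phi>new i j \<in> {0<..<1 / rho M N}"
    if "i \<in> {1..int m}" "j \<in> {1..int n}" for i j
    using assms(13,14) that by auto
  have rho: "1 / rho M N < 1"
    using rho_gt_1[OF assms(1,2)] by simp
  obtain C where C: "\<And>u v. u \<in> {0<..<1 / rho M N} \<Longrightarrow> v \<in> {0<..<1 / rho M N} \<Longrightarrow>
    S_fun M N v + (S_der M N v + C) * (u - v) \<le> S_fun M N u"
    using S_fun_above_tangent[OF assms(1,2)] by blast
  define k where "k = (\<lambda>i j. kappa (\<phi>new i j))"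
  define Px Py where "Px = a_x (\<lambda>i j. D_x hx \<phi>new i j * D_x hx e i j)"
    and "Py = a_y (\<lambda>i j. D_y hy \<phi>new i j * D_y hy e i j)"
  define Qx Qy where "Qx = d_x hx (\<lambda>i j. A_x k i j * D_x hx \<phi>new i j)"
    and "Qy = d_y hy (\<lambda>i j. A_y k i j * D_y hy \<phi>new i j)"
  define f where "f \<phi> i j = S_fun M N (\<phi> i j) + H_fun M N chi (\<phi> i j)
    + kappa (\<phi> i j) * grad_sq hx hy \<phi> i j" for \<phi> :: grid_fun and i j
  have per: "grid_periodic m n e" "grid_periodic m n k"
    unfolding e_def k_def using assms(11,12)
    by (auto intro: grid_periodic_diff grid_periodic_compose)
  have e: "e i j = - s * laplace_h hx hy \<mu> i j" if "i \<in> {1..int m}" "j \<in> {1..int n}" for i j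
    using assms(17) that by (fastforce simp: e_def)
  have by_parts: "(\<Sum>i = 1..int m. \<Sum>j = 1..int n. k i j * Px i j)
      = - (\<Sum>i = 1..int m. \<Sum>j = 1..int n. Qx i j * e i j)"
    "(\<Sum>i = 1..int m. \<Sum>j = 1..int n. k i j * Py i j)
      = - (\<Sum>i = 1..int m. \<Sum>j = 1..int n. Qy i j * e i j)"
    unfolding Px_def Py_def Qx_def Qy_def
    by (intro sum_mult_a_x_by_parts sum_mult_a_y_by_parts per assms)+
  \<comment> \<open>The terms \<open>2 * Qx i j * e i j\<close> and
    \<open>2 * Qy i j * e i j\<close> cancel the fluxes in \<open>\<mu>\<close>, leaving the three
    tangent inequalities. The two bracketed terms need not vanish in a single cell; they vanish
    after summation.\<close>
  have cell: "(\<mu> i j + (C + chi)) * e i j + 2 * (k i j * Px i j + Qx i j * e i j)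
      + 2 * (k i j * Py i j + Qy i j * e i j) \<le> f \<phi>old i j - f \<phi>new i j"
    if ij: "i \<in> {1..int m}" "j \<in> {1..int n}" for i j
  proof -
    have \<mu>: "\<mu> i j = S_der M N (\<phi>new i j) + kappa_der (\<phi>new i j) * grad_sq hx hy \<phi>new i j
        - 2 * Qx i j - 2 * Qy i j + H_der M N chi (\<phi>old i j)"
      using assms(16) ij by (simp add: scheme_potential_def Qx_def Qy_def k_def)
    have "kappa (\<phi>new i j) * grad_sq hx hy \<phi>new i j
        + kappa_der (\<phi>new i j) * grad_sq hx hy \<phi>new i j * e i j
        + 2 * (k i j * Px i j + k i j * Py i j) \<le> kappa (\<phi>old i j) * grad_sq hx hy \<phi>old i j"
      using kappa_mult_grad_sq_above_tangent[of \<phi>old i j \<phi>new hx hy] \<phi>old[OF ij] \<phi>new[OF ij] rho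
      by (simp add: k_def Px_def Py_def e_def)
    with C[OF \<phi>old[OF ij] \<phi>new[OF ij]]
      H_fun_below_tangent[OF assms(1-3), of "\<phi>new i j" "\<phi>old i j"]
    show ?thesis
      unfolding \<mu> f_def e_def by (simp add: algebra_simps)
  qed
  have zero_mean: "(\<Sum>i = 1..int m. \<Sum>j = 1..int n. e i j) = 0"
  proof -
    have "grid_periodic m n (\<lambda>i j. 1)"
      by (simp add: grid_periodic_def)
    \<comment> \<open>Testing with the constant 1, whose differences are zero, gives conservation of
      mass.\<close>
    from sum_laplace_h_mult[OF assms(15) this, of hx hy]
    have "(\<Sum>i = 1..int m. \<Sum>j = 1..int n. laplace_h hx hy \<mu> i j) = 0"
      by (simp add: a_x_def a_y_def D_x_def D_y_def)
    then show ?thesis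
      by (simp add: e sum_negf sum_distrib_left[symmetric])
  qed
  have "0 \<le> s * (\<Sum>i = 1..int m. \<Sum>j = 1..int n. grad_sq hx hy \<mu> i j)"
    using assms(10) by (intro mult_nonneg_nonneg sum_nonneg) (auto simp: grad_sq_def a_x_def a_y_def)
  also have "\<dots> = - s * (\<Sum>i = 1..int m. \<Sum>j = 1..int n. laplace_h hx hy \<mu> i j * \<mu> i j)"
    unfolding sum_laplace_h_mult[OF assms(15) assms(15)]
    by (simp add: grad_sq_def power2_eq_square)
  also have "\<dots> = (\<Sum>i = 1..int m. \<Sum>j = 1..int n. \<mu> i j * e i j)"
    by (simp add: e sum_distrib_left sum_negf mult_ac)
  \<comment> \<open>The inserted terms sum to zero: the constant \<open>C + chi\<close> by
    \<open>zero_mean\<close>, the others by \<open>by_parts\<close>.\<close>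
  also have "\<dots> = (\<Sum>i = 1..int m. \<Sum>j = 1..int n.
      (\<mu> i j + (C + chi)) * e i j + 2 * (k i j * Px i j + Qx i j * e i j)
      + 2 * (k i j * Py i j + Qy i j * e i j))"
    using zero_mean by_parts
    by (simp add: sum.distrib distrib_right sum_distrib_left[symmetric])
  also have "\<dots> \<le> (\<Sum>i = 1..int m. \<Sum>j = 1..int n. f \<phi>old i j - f \<phi>new i j)"
    by (intro sum_mono cell)
  finally have "(\<Sum>i = 1..int m. \<Sum>j = 1..int n. f \<phi>new i j)
      \<le> (\<Sum>i = 1..int m. \<Sum>j = 1..int n. f \<phi>old i j)"
    by (simp add: sum_subtractf)
  then show ?thesis
    unfolding discrete_energy_def f_def using assms(4-9)
    by (intro mult_left_mono) simp_all
qed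

end
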